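(* Let $G$ be a planar cubic bipartite graph and $uv$ an edge of $G$, and let $G'$ be the planar cubic bipartite graph obtained from $G$ by replacing the edge $uv$ with the gadget described below (in which $x$ is a designated vertex). Then $G$ contains a Hamiltonian cycle through the edge $uv$ if and only if $G'$ contains a trail of length $|V(G')| + 1$ starting at $x$.
   Context: A trail is a walk with no repeated edge; its length is its number of edges. The gadget: delete the edge $uv$ and add four disjoint copies $A, B, C, D$ of the following 8-vertex graph $W$ with vertices $g_1,\dots,g_8$: $W$ has the 8-cycle $g_1g_2g_3g_4g_5g_8g_7g_6g_1$ together with the chords $g_2g_7$, $g_3g_8$, $g_5g_6$ (so $g_1, g_4$ have degree $2$ in $W$ and all other vertices degree $3$). Write $g_i^A$ etc. for the copies. Add two new vertices $x$ and $y$ and the edges $u g_1^A$, $g_4^A x$, $x g_1^B$, $x g_1^D$, $g_4^B y$, $g_4^D y$, $y g_1^C$, $g_4^C v$. The resulting graph $G'$ is planar, cubic and bipartite. *)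

theory Defs
  imports "HOL-Analysis.Analysis"
begin

type_synonym 'a ugraph = "'a set \<times> 'a set set"

abbreviation verts :: "'a ugraph \<Rightarrow> 'a set" where
  "verts G \<equiv> fst G"

abbreviation edges :: "'a ugraph \<Rightarrow> 'a set set" where
  "edges G \<equiv> snd G"

definition simple_graph :: "'a ugraph \<Rightarrow> bool" where
  "simple_graph G \<longleftrightarrow> finite (verts G) \<and> (\<forall>e\<in>edges G. e \<subseteq> verts G \<and> card e = 2)"

definition degree :: "'a ugraph \<Rightarrow> 'a \<Rightarrow> nat" where
  "degree G v = card {e \<in> edges G. v \<in> e}"

definition cubic :: "'a ugraph \<Rightarrow> bool" where
  "cubic G \<longleftrightarrow> (\<forall>v\<in>verts G. degree G v = 3)"

definition bipartite :: "'a ugraph \<Rightarrow> bool" where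
  "bipartite G \<longleftrightarrow> (\<exists>P Q. P \<union> Q = verts G \<and> P \<inter> Q = {} \<and>
     (\<forall>e\<in>edges G. \<exists>p\<in>P. \<exists>q\<in>Q. e = {p, q}))"

text \<open>A plane drawing: vertices are distinct points, each edge is a simple arc joining the
  points of its two ends, arcs contain no other vertex points, and two distinct arcs meet
  only in points of common ends.\<close>

definition planar :: "'a ugraph \<Rightarrow> bool" where
  "planar G \<longleftrightarrow> (\<exists>(pos :: 'a \<Rightarrow> real^2) (\<gamma> :: 'a set \<Rightarrow> real \<Rightarrow> real^2).
     inj_on pos (verts G) \<and>
     (\<forall>e\<in>edges G. arc (\<gamma> e) \<and> {pathstart (\<gamma> e), pathfinish (\<gamma> e)} = pos ` e \<and>
        path_image (\<gamma> e) \<inter> pos ` verts G = pos ` e) \<and>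
     (\<forall>e\<in>edges G. \<forall>f\<in>edges G. e \<noteq> f \<longrightarrow>
        path_image (\<gamma> e) \<inter> path_image (\<gamma> f) \<subseteq> pos ` (e \<inter> f)))"

text \<open>Graphs are simple, so a walk is determined by its nonempty list of vertices. Its length
  is the length of the list of traversed edges, one less than that of the vertex list.\<close>

fun walk_edges :: "'a list \<Rightarrow> 'a set list" where
  "walk_edges (a # b # p) = {a, b} # walk_edges (b # p)"
| "walk_edges _ = []"

definition walk :: "'a ugraph \<Rightarrow> 'a list \<Rightarrow> bool" where
  "walk G p \<longleftrightarrow> p \<noteq> [] \<and> set p \<subseteq> verts G \<and> set (walk_edges p) \<subseteq> edges G"

definition trail :: "'a ugraph \<Rightarrow> 'a list \<Rightarrow> bool" where
  "trail G p \<longleftrightarrow> walk G p \<and> distinct (walk_edges p)"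

definition walk_length :: "'a list \<Rightarrow> nat" where
  "walk_length p = length (walk_edges p)"

text \<open>A cycle is given by a vertex list whose first vertex is repeated at the end.\<close>

definition cycle :: "'a ugraph \<Rightarrow> 'a list \<Rightarrow> bool" where
  "cycle G p \<longleftrightarrow> walk G p \<and> hd p = last p \<and> distinct (tl p) \<and> walk_length p \<ge> 3"

definition hamiltonian_cycle :: "'a ugraph \<Rightarrow> 'a list \<Rightarrow> bool" where
  "hamiltonian_cycle G p \<longleftrightarrow> cycle G p \<and> set p = verts G"

definition W_verts :: "nat set" where
  "W_verts = {1..8}"

definition W_edges :: "nat set set" where
  "W_edges =
     {{1,2}, {2,3}, {3,4}, {4,5}, {5,8}, {8,7}, {7,6}, {6,1}} \<union>
     {{2,7}, {3,8}, {5,6}}"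

datatype copy = CopyA | CopyB | CopyC | CopyD

text \<open>\<open>W c i\<close> is the vertex $g_i$ of copy \<open>c\<close>; only \<open>i \<in> W_verts\<close> is used.\<close>

datatype 'a gvert = Old 'a | W copy nat | X | Y

definition replace_edge :: "'a ugraph \<Rightarrow> 'a \<Rightarrow> 'a \<Rightarrow> 'a gvert ugraph" where
  "replace_edge G u v =
     (Old ` verts G \<union> {W c i | c i. i \<in> W_verts} \<union> {X, Y},
      (`) Old ` (edges G - {{u, v}}) \<union>
      {W c ` e | c e. e \<in> W_edges} \<union>
      {{Old u, W CopyA 1}, {W CopyA 4, X},
       {X, W CopyB 1}, {X, W CopyD 1},
       {W CopyB 4, Y}, {W CopyD 4, Y},
       {Y, W CopyC 1}, {W CopyC 4, Old v}})"

end

theory Submission imports Defs begin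

text \<open>In a graph of maximum degree three, a trail of length \<open>|V| + 1\<close> visits every vertex, and
  visits every vertex other than its two ends only once: a passage through a vertex consumes two of
  its edges. A trail crosses a cut an even number of times unless the cut separates its ends. Each
  of \<open>A\<close>, \<open>C\<close> and the old vertex set is attached to the rest by two edges only. If a
  trail from \<open>x\<close> ended in an old vertex, it would cross the boundaries of \<open>A\<close> and
  \<open>C\<close> at both of their edges, hence the boundary of the old vertex set exactly twice, which
  has the wrong parity. So the trail enters and leaves the old vertex set exactly once, and there it
  is a Hamiltonian path from \<open>u\<close> to \<open>v\<close>. Conversely, such a path extends to the trail
  \<open>x B y D x A u \<dots> v C y\<close>, as \<open>W\<close> has a Hamiltonian path from
  \<open>g\<^sub>1\<close> to \<open>g\<^sub>4\<close>.\<close>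

section \<open>Edges of walks\<close>

lemma walk_edges_Cons: "p \<noteq> [] \<Longrightarrow> walk_edges (a # p) = {a, hd p} # walk_edges p"
  by (cases p) auto

lemma walk_edges_append:
  "p \<noteq> [] \<Longrightarrow> q \<noteq> [] \<Longrightarrow>
   walk_edges (p @ q) = walk_edges p @ {last p, hd q} # walk_edges q"
  by (induction p rule: walk_edges.induct) (auto simp: walk_edges_Cons)

lemma length_walk_edges: "length (walk_edges p) = length p - 1"
  by (induction p rule: walk_edges.induct) auto

lemma walk_edges_rev: "walk_edges (rev p) = rev (walk_edges p)"
proof (induction p)
  case (Cons a p)
  then show ?case
    by (cases "p = []") (auto simp: walk_edges_append walk_edges_Cons last_rev insert_commute)
qed simp

lemma walk_edges_map: "walk_edges (map f p) = map ((`) f) (walk_edges p)"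
  by (induction p rule: walk_edges.induct) auto

lemma walk_edges_subset: "e \<in> set (walk_edges p) \<Longrightarrow> e \<subseteq> set p"
  by (induction p rule: walk_edges.induct) auto

lemma walk_edges_nonempty: "e \<in> set (walk_edges p) \<Longrightarrow> e \<noteq> {}"
  by (induction p rule: walk_edges.induct) auto

lemma distinct_walk_edges: "distinct p \<Longrightarrow> distinct (walk_edges p)"
  by (induction p rule: walk_edges.induct) (auto dest: walk_edges_subset)

text \<open>Gluing two walks at a shared vertex, which \<open>tl\<close> keeps from being listed
  twice. It serves to reread a closed walk from another starting point.\<close>

lemma set_walk_edges_join:
  assumes "p \<noteq> []" "q \<noteq> []" "last p = hd q"
  shows "set (walk_edges (p @ tl q)) = set (walk_edges p) \<union> set (walk_edges q)"
  using assms
  by (cases q; cases "tl q = []") (auto simp: walk_edges_append walk_edges_Cons)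

text \<open>On a path the first vertex lies on just one edge, and that edge leads to the second
  vertex, which is not the last one once there are three.\<close>

lemma ends_notin_walk_edges:
  assumes "distinct p" "length p \<ge> 3"
  shows "{hd p, last p} \<notin> set (walk_edges p)"
proof -
  obtain a b r where p: "p = a # b # r" "r \<noteq> []"
    using assms(2) by (cases p; cases "tl p"; cases "tl (tl p)") auto
  have "last r \<in> set r" using p(2) by simp
  then have "{a, last r} \<noteq> {a, b}" using assms(1) p by (auto simp: doubleton_eq_iff)
  moreover have "{a, last r} \<notin> set (walk_edges (b # r))"
    using assms(1) p(1) walk_edges_subset[of "{a, last r}" "b # r"] by auto
  ultimately show ?thesis using p by simp
qed

lemma split_at_walk_edge:
  assumes "e \<in> set (walk_edges p)"
  obtains a s t b where "p = (a @ [s]) @ t # b" "e = {s, t}"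
  using assms
proof (induction p arbitrary: thesis rule: walk_edges.induct)
  case (1 x y p)
  show ?case
  proof (cases "e = {x, y}")
    case True
    then show ?thesis using "1.prems"(1)[of "[]" x y p] by simp
  next
    case False
    then have "e \<in> set (walk_edges (y # p))" using "1.prems"(2) by simp
    then obtain a s t b where "y # p = (a @ [s]) @ t # b" "e = {s, t}" using "1.IH" by blast
    then show ?thesis using "1.prems"(1)[of "x # a" s t b] by simp
  qed
qed auto

text \<open>An entry \<open>w\<close> touches one edge on its left and one on its right, except that
  the first and the last entry lack one side each; the two indicators make up for these. Edges of
  size 2 exclude loops, which would fill two sides but be counted once.\<close>

lemma count_list_walk_edges:
  assumes "p \<noteq> []" "\<forall>e\<in>set (walk_edges p). card e = 2"
  shows "length (filter (\<lambda>e. w \<in> e) (walk_edges p)) + of_bool (w = hd p) + of_bool (w = last p)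
       = 2 * count_list p w"
  using assms
  by (induction p rule: walk_edges.induct) (auto split: if_splits)

lemma sum_count_list_superset:
  assumes "set p \<subseteq> A" "finite A"
  shows "(\<Sum>x\<in>A. count_list p x) = length p"
proof -
  have "(\<Sum>x\<in>A. count_list p x) = (\<Sum>x\<in>set p. count_list p x)"
    using assms by (intro sum.mono_neutral_right) (auto simp: count_list_0_iff)
  then show ?thesis by (simp add: sum_count_set)
qed

lemma count_list_le_1_imp_distinct:
  assumes "\<And>x. count_list xs x \<le> 1"
  shows "distinct xs"
  using assms
proof (induction xs)
  case (Cons a xs)
  have "count_list xs x \<le> 1" for x using Cons.prems[of x] by (auto split: if_splits)
  moreover have "count_list xs a = 0" using Cons.prems[of a] by simp
  ultimately show ?case using Cons.IH count_list_0_iff[of xs a] by simp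
qed simp

section \<open>Cuts crossed by a walk\<close>

definition crossing :: "'a set \<Rightarrow> 'a set \<Rightarrow> bool" where
  "crossing U e \<longleftrightarrow> e \<inter> U \<noteq> {} \<and> e - U \<noteq> {}"

text \<open>Every crossing edge switches between \<open>U\<close> and its complement, and no other
  edge does.\<close>

lemma even_crossings:
  assumes "p \<noteq> []"
  shows "even (length (filter (crossing U) (walk_edges p))) \<longleftrightarrow> (hd p \<in> U \<longleftrightarrow> last p \<in> U)"
  using assms by (induction p rule: walk_edges.induct) (auto simp: crossing_def)

lemma crossing_exists:
  assumes "p \<noteq> []" "hd p \<notin> U" "set p \<inter> U \<noteq> {}"
  shows "\<exists>e\<in>set (walk_edges p). crossing U e"
  using assms by (induction p rule: walk_edges.induct) (auto simp: crossing_def)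

text \<open>The number of crossings is even since both ends lie outside \<open>U\<close>, and
  nonzero since \<open>U\<close> is visited. So there are at least two, they are pairwise distinct,
  and only \<open>a\<close> and \<open>b\<close> are available.\<close>

lemma both_crossings:
  assumes p: "p \<noteq> []" "hd p \<notin> U" "last p \<notin> U" "set p \<inter> U \<noteq> {}"
    and dist: "distinct (walk_edges p)"
    and cut: "\<And>e. e \<in> set (walk_edges p) \<Longrightarrow> crossing U e \<Longrightarrow> e = a \<or> e = b"
  shows "a \<in> set (walk_edges p)" "b \<in> set (walk_edges p)"
proof -
  define F where "F = filter (crossing U) (walk_edges p)"
  have ev: "even (length F)" using even_crossings[of p U] p by (simp add: F_def)
  have ne: "F \<noteq> []" using crossing_exists[of p U] p by (auto simp: F_def filter_empty_conv)
  have "distinct F" using dist by (simp add: F_def)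
  then have c: "card (set F) = length F" by (rule distinct_card)
  have "set F \<subseteq> {a, b}" using cut by (auto simp: F_def)
  moreover have "length F \<ge> 2"
  proof -
    have "length F \<noteq> 0" "length F \<noteq> 1" using ev ne by auto
    then show ?thesis by linarith
  qed
  then have "card {a, b} \<le> card (set F)" using c by (simp add: card_insert_if)
  ultimately have "set F = {a, b}" by (intro card_seteq) auto
  then show "a \<in> set (walk_edges p)" "b \<in> set (walk_edges p)" by (auto simp: F_def)
qed

text \<open>Entering \<open>U\<close> for the first time and leaving it again already uses up both
  cut edges, so a trail cannot come back.\<close>

lemma single_block:
  assumes p: "p \<noteq> []" "hd p \<notin> U" "last p \<notin> U" "set p \<inter> U \<noteq> {}"
    and dist: "distinct (walk_edges p)"
    and cut: "\<And>e. e \<in> set (walk_edges p) \<Longrightarrow> crossing U e \<Longrightarrow> e = a \<or> e = b"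
  obtains p1 q p2 where "p = p1 @ q @ p2" "p1 \<noteq> []" "q \<noteq> []" "p2 \<noteq> []"
    "set p1 \<inter> U = {}" "set q \<subseteq> U" "set p2 \<inter> U = {}"
    "{{last p1, hd q}, {last q, hd p2}} = {a, b}"
proof -
  define p1 where "p1 = takeWhile (\<lambda>x. x \<notin> U) p"
  define r where "r = dropWhile (\<lambda>x. x \<notin> U) p"
  define q where "q = takeWhile (\<lambda>x. x \<in> U) r"
  define p2 where "p2 = dropWhile (\<lambda>x. x \<in> U) r"
  have eq: "p = p1 @ q @ p2" by (simp add: p1_def q_def p2_def r_def)
  have r: "r \<noteq> []" using p(4) by (auto simp: r_def)
  have hr: "hd r \<in> U" using hd_dropWhile[of "\<lambda>x. x \<notin> U" p] r by (simp add: r_def)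
  have q: "q \<noteq> []" using r hr by (cases r) (auto simp: q_def)
  have p1: "p1 \<noteq> []" using p(1,2) by (cases p) (auto simp: p1_def)
  have U1: "set p1 \<inter> U = {}" by (auto simp: p1_def dest: set_takeWhileD)
  have Uq: "set q \<subseteq> U" by (auto simp: q_def dest: set_takeWhileD)
  have "last q \<in> U" using last_in_set[OF q] Uq by blast
  then have p2: "p2 \<noteq> []" using p(3) q by (auto simp: eq)
  have h2: "hd p2 \<notin> U" using hd_dropWhile[of "\<lambda>x. x \<in> U" r] p2 by (simp add: p2_def)
  have we: "walk_edges p = walk_edges p1 @ {last p1, hd q} # walk_edges q
      @ {last q, hd p2} # walk_edges p2"
    using p1 q p2 by (simp add: eq walk_edges_append)
  have "last p1 \<notin> U" "hd q \<in> U" "last q \<in> U" using U1 Uq p1 q last_in_set[of p1] last_in_set[of q] hd_in_set[of q] by blast+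
  then have cr: "crossing U {last p1, hd q}" "crossing U {last q, hd p2}"
    using h2 by (auto simp: crossing_def)
  \<comment> \<open>The two crossings are different edges because the walk repeats none, so they
    exhaust \<open>a\<close> and \<open>b\<close> in some order.\<close>
  then have ab: "{{last p1, hd q}, {last q, hd p2}} = {a, b}"
    using cut[of "{last p1, hd q}"] cut[of "{last q, hd p2}"] dist we by auto
  have "set p2 \<inter> U = {}"
  proof (rule ccontr)
    assume "set p2 \<inter> U \<noteq> {}"
    then obtain e where e: "e \<in> set (walk_edges p2)" "crossing U e"
      using crossing_exists[of p2 U] p2 h2 by blast
    then have "e \<in> {a, b}" using cut we by auto
    then have "e \<in> {{last p1, hd q}, {last q, hd p2}}" using ab by simp
    then show False using e(1) dist we by auto
  qed
  then show thesis using that eq p1 q p2 U1 Uq ab by blast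
qed

section \<open>How often a trail of length |V| + 1 visits each vertex\<close>

lemma long_trail_visits:
  assumes "finite (verts G)" "\<And>e. e \<in> edges G \<Longrightarrow> card e = 2"
    and deg: "\<And>w. w \<in> verts G \<Longrightarrow> finite {e \<in> edges G. w \<in> e} \<and> degree G w \<le> 3"
    and "trail G p" "walk_length p = card (verts G) + 1"
  shows "hd p \<noteq> last p" "set p = verts G"
    "\<And>w. w \<noteq> hd p \<Longrightarrow> w \<noteq> last p \<Longrightarrow> count_list p w \<le> 1"
proof -
  have p: "p \<noteq> []" "set p \<subseteq> verts G" "set (walk_edges p) \<subseteq> edges G" "distinct (walk_edges p)"
    using assms(4) by (auto simp: trail_def walk_def)
  have len: "length p = card (verts G) + 2"
    using assms(5) p(1) by (simp add: walk_length_def length_walk_edges)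
  \<comment> \<open>Edges at \<open>w\<close> are used at most once each, so at most three of them
    contribute to the count of \<open>count_list_walk_edges\<close>.\<close>
  have key: "2 * count_list p w \<le> 3 + of_bool (w = hd p) + of_bool (w = last p)"
    if "w \<in> verts G" for w
  proof -
    have "length (filter (\<lambda>e. w \<in> e) (walk_edges p)) = card (set (filter (\<lambda>e. w \<in> e) (walk_edges p)))"
      using p(4) by (metis distinct_card distinct_filter)
    also have "\<dots> \<le> card {e \<in> edges G. w \<in> e}"
      using deg[OF that] p(3) by (intro card_mono) auto
    also have "\<dots> \<le> 3" using deg[OF that] by (simp add: degree_def)
    finally have "length (filter (\<lambda>e. w \<in> e) (walk_edges p)) \<le> 3" .
    moreover have "\<forall>e\<in>set (walk_edges p). card e = 2" using p(3) assms(2) by blast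
    ultimately show ?thesis using count_list_walk_edges[OF p(1), of w] by linarith
  qed
  have hl: "hd p \<in> verts G" "last p \<in> verts G" using p(1,2) by auto
  \<comment> \<open>Halving \<open>key\<close> and rounding down gives 1 for an inner vertex and 2
    for an end. The bound is still 2 when the ends coincide, as then 2 * count <= 5.\<close>
  have b: "count_list p w \<le> 1 + of_bool (w = hd p \<or> w = last p)" if "w \<in> verts G" for w
    using key[OF that] by (auto simp: of_bool_def split: if_splits)
  show "count_list p w \<le> 1" if "w \<noteq> hd p" "w \<noteq> last p" for w
    using b[of w] that p(2) count_list_0_iff[of p w] by (cases "w \<in> verts G") auto
  have eq: "{x \<in> verts G. x = hd p \<or> x = last p} = {hd p, last p}" using hl by auto
  have tot: "(\<Sum>w\<in>verts G. 1 + of_bool (w = hd p \<or> w = last p)) = card (verts G) + card {hd p, last p}"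
    using assms(1) by (simp only: sum.distrib sum_of_bool_eq) (simp add: eq Int_def conj_commute)
  \<comment> \<open>The list has |V| + 2 entries, while the bounds \<open>b\<close> add up to |V|
    plus the number of different ends. So the ends differ and every bound is attained; a missed
    vertex would make the sum too small.\<close>
  have "length p \<le> card (verts G) + card {hd p, last p}"
    using sum_mono[OF b, of "verts G" "\<lambda>w. w"] sum_count_list_superset[OF p(2) assms(1)] tot by simp
  then show ne: "hd p \<noteq> last p" using len by auto
  show "set p = verts G"
  proof (rule ccontr)
    assume "set p \<noteq> verts G"
    then obtain z where z: "z \<in> verts G" "z \<notin> set p" using p(2) by auto
    have "(\<Sum>w\<in>verts G. count_list p w) < (\<Sum>w\<in>verts G. 1 + of_bool (w = hd p \<or> w = last p))"
      by (rule sum_strict_mono_ex1[OF assms(1)]) (use b z in \<open>auto intro!: bexI[of _ z]\<close>)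
    then show False using tot sum_count_list_superset[OF p(2) assms(1)] len ne by simp
  qed
qed

section \<open>Hamiltonian cycles through an edge as Hamiltonian paths\<close>

lemma hamiltonian_cycle_iff_path:
  assumes "{u, v} \<in> edges G" "u \<noteq> v"
  shows "(\<exists>p. hamiltonian_cycle G p \<and> {u, v} \<in> set (walk_edges p)) \<longleftrightarrow>
    (\<exists>q. q \<noteq> [] \<and> distinct q \<and> set q = verts G \<and> set (walk_edges q) \<subseteq> edges G - {{u, v}} \<and>
       hd q = u \<and> last q = v)" (is "_ \<longleftrightarrow> (\<exists>q. ?path q)")
proof
  assume "\<exists>p. hamiltonian_cycle G p \<and> {u, v} \<in> set (walk_edges p)"
  then obtain p where p: "hd p = last p" "distinct (tl p)" "length (walk_edges p) \<ge> 3"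
      "set p = verts G" "set (walk_edges p) \<subseteq> edges G" and uv: "{u, v} \<in> set (walk_edges p)"
    by (auto simp: hamiltonian_cycle_def cycle_def walk_def walk_length_def)
  obtain a s t b where eq: "p = (a @ [s]) @ t # b" and st: "{u, v} = {s, t}"
    using split_at_walk_edge[OF uv] by metis
  \<comment> \<open>The cycle is cut open at the edge from \<open>s\<close> to \<open>t\<close>:
    read on from \<open>t\<close> to the end of \<open>p\<close>, which is also its start, and from
    there to \<open>s\<close>. The \<open>tl\<close> drops the second copy of that base
    vertex.\<close>
  define q where "q = (t # b) @ tl (a @ [s])"
  have q0: "hd q = t" "q \<noteq> []" by (auto simp: q_def)
  have perm: "mset q = mset (tl p)"
    by (cases a) (auto simp: q_def eq)
  have dq: "distinct q" using perm p(2) mset_eq_imp_distinct_iff by blast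
  have lp: "length p \<ge> 4" using p(3) by (simp add: length_walk_edges)
  have lq: "length q \<ge> 3" using lp mset_eq_length[OF perm] by simp
  have "set p = insert (last p) (set (tl p))" using p(1) by (metis eq list.exhaust_sel list.simps(15) append_is_Nil_conv list.distinct(1))
  moreover have "last p \<in> set (tl p)" by (cases a) (auto simp: eq)
  ultimately have sq: "set q = verts G" using p(4) mset_eq_setD[OF perm] by auto
  have j: "last (t # b) = hd (a @ [s])" using p(1) by (cases a) (auto simp: eq)
  have lastq: "last q = s"
  proof (cases a)
    case Nil then show ?thesis using j by (simp add: q_def)
  qed (simp add: q_def)
  have wq: "set (walk_edges q) = set (walk_edges (t # b)) \<union> set (walk_edges (a @ [s]))"
    unfolding q_def using j by (intro set_walk_edges_join) auto
  have "walk_edges p = walk_edges (a @ [s]) @ {s, t} # walk_edges (t # b)"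
    unfolding eq by (subst walk_edges_append) auto
  then have "set (walk_edges q) \<subseteq> edges G" using wq p(5) by auto
  moreover have "{u, v} \<notin> set (walk_edges q)"
    using ends_notin_walk_edges[OF dq lq] q0(1) lastq st by (simp add: insert_commute)
  ultimately have wq': "set (walk_edges q) \<subseteq> edges G - {{u, v}}" by blast
  show "\<exists>q. ?path q"
  \<comment> \<open>The cycle may traverse the edge in either direction; in the other one the path
    has to be reversed.\<close>
  proof (cases "t = u")
    case True
    then have "s = v" using st by (auto simp: doubleton_eq_iff)
    then have "?path q" using True q0 lastq dq sq wq' by simp
    then show ?thesis ..
  next
    case False
    then have "s = u" "t = v" using st by (auto simp: doubleton_eq_iff)
    then have "?path (rev q)" using q0 lastq dq sq wq' by (simp add: walk_edges_rev hd_rev last_rev)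
    then show ?thesis ..
  qed
next
  assume "\<exists>q. ?path q"
  then obtain q where q: "?path q" ..
  then obtain r where r: "q = u # r" by (cases q) auto
  then obtain z r' where r': "r = z # r'" using q assms(2) by (cases r) auto
  \<comment> \<open>The list \<open>[u, v]\<close> would use the forbidden edge, so closing up gives
    a cycle of length at least 3.\<close>
  have "r' \<noteq> []" using q r r' by auto
  then have l3: "length q \<ge> 3" using r r' by (cases r') auto
  have w: "walk_edges (q @ [u]) = walk_edges q @ [{v, u}]"
    using q by (subst walk_edges_append) auto
  have "hamiltonian_cycle G (q @ [u]) \<and> {u, v} \<in> set (walk_edges (q @ [u]))"
    using q w l3 r assms(1)
    by (auto simp: hamiltonian_cycle_def cycle_def walk_def walk_length_def length_walk_edges insert_commute)
  then show "\<exists>p. hamiltonian_cycle G p \<and> {u, v} \<in> set (walk_edges p)" by blast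
qed

section \<open>The gadget\<close>

lemma finite_replace_edge_verts: "finite (verts G) \<Longrightarrow> finite (verts (replace_edge G u v))"
  and card_replace_edge_verts:
    "finite (verts G) \<Longrightarrow> card (verts (replace_edge G u v)) = card (verts G) + 34"
proof -
  assume fin: "finite (verts G)"
  have W: "{W c i | c i. i \<in> W_verts} = (\<lambda>(c, i). W c i) ` ({CopyA, CopyB, CopyC, CopyD} \<times> {1..8})"
    (is "?W = ?f ` ?D")
    by (auto simp: W_verts_def image_iff intro: copy.exhaust)
  have inj: "inj_on ?f ?D" by (auto simp: inj_on_def)
  have finW: "finite ?W" by (subst W) auto
  have cW: "card ?W = 32" by (subst W, subst card_image[OF inj]) (simp add: card_cartesian_product)
  have eq: "verts (replace_edge G u v) = Old ` verts G \<union> (?W \<union> {X, Y})"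
    by (auto simp: replace_edge_def)
  show "finite (verts (replace_edge G u v))" using fin finW eq by simp
  have "card (?W \<union> {X, Y}) = 34" using finW cW by (subst card_Un_disjoint) auto
  moreover have "card (Old ` verts G) = card (verts G)" by (simp add: card_image inj_on_def)
  ultimately show "card (verts (replace_edge G u v)) = card (verts G) + 34"
    unfolding eq using fin finW by (subst card_Un_disjoint) auto
qed

section \<open>Edge sizes and degrees in the new graph\<close>

lemma replace_edge_card2:
  assumes "simple_graph G" "e \<in> edges (replace_edge G u v)"
  shows "card e = 2"
proof -
  have "card f = 2" if "f \<in> W_edges" for f using that by (auto simp: W_edges_def)
  moreover have "card (Old ` f) = card f" "card (W c ` g :: 'a gvert set) = card g"
    for f :: "'a set" and c g
    by (simp_all add: card_image inj_on_def)
  ultimately show ?thesis using assms by (auto simp: replace_edge_def simple_graph_def)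
qed

text \<open>Finiteness is recorded along with the bound because \<open>card\<close> of an infinite
  set is 0, so a small \<open>degree\<close> alone would not limit the number of edges at
  \<open>w\<close>.\<close>

lemma degree_le3I:
  assumes "{e \<in> edges G. w \<in> e} \<subseteq> {a, b, c}"
  shows "finite {e \<in> edges G. w \<in> e} \<and> degree G w \<le> 3"
proof -
  have "card {e \<in> edges G. w \<in> e} \<le> card {a, b, c}" by (rule card_mono[OF _ assms]) simp
  also have "\<dots> \<le> 3" by (simp add: card_insert_if)
  finally show ?thesis using finite_subset[OF assms] by (simp add: degree_def)
qed

lemma replace_edge_degree_W:
  assumes "i \<in> W_verts"
  shows "\<exists>a b d. {e \<in> edges (replace_edge G (u :: 'a) v). W c i \<in> e} \<subseteq> {a, b, d}"
proof -
  \<comment> \<open>The edge by which copy \<open>c\<close> is attached at its vertex 1 or 4. For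
    other \<open>i\<close> the value is a mere default and is never inserted below.\<close>
  define ext where "ext = (case c of
      CopyA \<Rightarrow> if i = 1 then {Old u, W CopyA 1} else {W CopyA 4, X}
    | CopyB \<Rightarrow> if i = 1 then {X, W CopyB 1} else {W CopyB 4, Y}
    | CopyC \<Rightarrow> if i = 1 then {Y, W CopyC 1} else {W CopyC 4, Old v}
    | CopyD \<Rightarrow> if i = 1 then {X, W CopyD 1} else {W CopyD 4, Y})"
  have outer: "{e \<in> edges (replace_edge G u v). W c i \<in> e} \<subseteq>
      (`) (W c) ` {e \<in> W_edges. i \<in> e} \<union> (if i = 1 \<or> i = 4 then {ext} else {})"
    by (cases c) (auto simp: replace_edge_def ext_def)
  \<comment> \<open>The clause \<open>b = d\<close> records that vertices 1 and 4 have only two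
    edges inside the copy, which leaves the third place for \<open>ext\<close>.\<close>
  have I: "\<exists>a b d. {e \<in> W_edges. i \<in> e} \<subseteq> {a, b, d} \<and> (i = 1 \<or> i = 4 \<longrightarrow> b = d)"
    if "\<And>e. e \<in> W_edges \<Longrightarrow> i \<in> e \<Longrightarrow> e \<in> {a, b, d}" "i = 1 \<or> i = 4 \<longrightarrow> b = d" for a b d
  proof -
    have "{e \<in> W_edges. i \<in> e} \<subseteq> {a, b, d}" using that(1) by blast
    then show ?thesis using that(2) by (intro exI conjI)
  qed
  have "i = 1 \<or> i = 2 \<or> i = 3 \<or> i = 4 \<or> i = 5 \<or> i = 6 \<or> i = 7 \<or> i = 8"
    using assms by (auto simp: W_verts_def)
  then consider "i = 1" | "i = 2" | "i = 3" | "i = 4" | "i = 5" | "i = 6" | "i = 7" | "i = 8"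
    by argo
  then have "\<exists>a b d. {e \<in> W_edges. i \<in> e} \<subseteq> {a, b, d} \<and> (i = 1 \<or> i = 4 \<longrightarrow> b = d)"
  proof cases
    case 1
    show ?thesis by (rule I[of "{1,2}" "{6,1}" "{6,1}"]) (simp_all add: 1 W_edges_def, elim disjE, simp_all)
  next
    case 2
    show ?thesis by (rule I[of "{1,2}" "{2,3}" "{2,7}"]) (simp_all add: 2 W_edges_def, elim disjE, simp_all)
  next
    case 3
    show ?thesis by (rule I[of "{2,3}" "{3,4}" "{3,8}"]) (simp_all add: 3 W_edges_def, elim disjE, simp_all)
  next
    case 4
    show ?thesis by (rule I[of "{3,4}" "{4,5}" "{4,5}"]) (simp_all add: 4 W_edges_def, elim disjE, simp_all)
  next
    case 5
    show ?thesis by (rule I[of "{4,5}" "{5,8}" "{5,6}"]) (simp_all add: 5 W_edges_def, elim disjE, simp_all)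
  next
    case 6
    show ?thesis by (rule I[of "{7,6}" "{6,1}" "{5,6}"]) (simp_all add: 6 W_edges_def, elim disjE, simp_all)
  next
    case 7
    show ?thesis by (rule I[of "{8,7}" "{7,6}" "{2,7}"]) (simp_all add: 7 W_edges_def, elim disjE, simp_all)
  next
    case 8
    show ?thesis by (rule I[of "{5,8}" "{8,7}" "{3,8}"]) (simp_all add: 8 W_edges_def, elim disjE, simp_all)
  qed
  then obtain a b d where ab: "{e \<in> W_edges. i \<in> e} \<subseteq> {a, b, d}" "i = 1 \<or> i = 4 \<longrightarrow> b = d"
    by (elim exE conjE)
  have "(`) (W c) ` {e \<in> W_edges. i \<in> e} \<subseteq> {W c ` a, W c ` b, W c ` d :: 'a gvert set}"
    using image_mono[OF ab(1), of "(`) (W c)"] by simp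
  then have *: "{e \<in> edges (replace_edge G u v). W c i \<in> e} \<subseteq>
      {W c ` a, W c ` b, W c ` d} \<union> (if i = 1 \<or> i = 4 then {ext} else {})"
    by (rule order_trans[OF outer Un_mono[OF _ order_refl]])
  show ?thesis
  proof (cases "i = 1 \<or> i = 4")
    case True
    then have "{W c ` a, W c ` b, W c ` d} \<union> (if i = 1 \<or> i = 4 then {ext} else {}) =
        {W c ` a, W c ` b, ext}"
      using ab(2) by auto
    then show ?thesis using * by (intro exI) (simp only:)
  next
    case False
    then have "{W c ` a, W c ` b, W c ` d} \<union> (if i = 1 \<or> i = 4 then {ext} else {}) =
        {W c ` a, W c ` b, W c ` d}"
      by simp
    then show ?thesis using * by (intro exI) (simp only:)
  qed
qed

text \<open>At \<open>u\<close> and at \<open>v\<close> one edge to the gadget takes the place of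
  \<open>{u, v}\<close>; at any other old vertex the edges are only renamed.\<close>

lemma replace_edge_degree_Old:
  assumes "simple_graph G" "cubic G" "{u, v} \<in> edges G" "w \<in> verts G"
  defines "E \<equiv> {e \<in> edges (replace_edge G u v). Old w \<in> e}"
  shows "finite E \<and> card E \<le> 3"
proof -
  define D where "D = {e \<in> edges G. w \<in> e}"
  have uv: "u \<noteq> v" using assms(1,3) by (auto simp: simple_graph_def)
  have D: "card D = 3" using assms(2,4) by (auto simp: D_def cubic_def degree_def)
  then have fin: "finite D" by (metis card.infinite numeral_eq_Suc zero_neq_one nat.simps(3))
  show ?thesis
  proof (cases "w = u \<or> w = v")
    case True
    define ext where "ext = (if w = u then {Old u, W CopyA 1} else {W CopyC 4, Old v})"
    have E: "E \<subseteq> insert ext ((`) Old ` (D - {{u, v}}))"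
      using True uv by (auto simp: E_def D_def replace_edge_def ext_def)
    have "{u, v} \<in> D" using True assms(3) by (auto simp: D_def)
    then have "card (D - {{u, v}}) = 2" using D fin by simp
    then have "card ((`) Old ` (D - {{u, v}})) \<le> 2" using card_image_le[of "D - {{u, v}}" "(`) Old"] fin by simp
    then have "card (insert ext ((`) Old ` (D - {{u, v}}))) \<le> 3"
      using fin by (simp add: card_insert_if)
    then show ?thesis using E card_mono[OF _ E] fin finite_subset[OF E] by auto
  next
    case False
    then have E: "E \<subseteq> (`) Old ` D" by (auto simp: E_def D_def replace_edge_def)
    then show ?thesis using D fin card_mono[OF _ E] card_image_le[OF fin, of "(`) Old"] finite_subset[OF E]
      by auto
  qed
qed

lemma replace_edge_degree:
  assumes "simple_graph G" "cubic G" "{u, v} \<in> edges G" "w \<in> verts (replace_edge G u v)"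
  shows "finite {e \<in> edges (replace_edge G u v). w \<in> e} \<and> degree (replace_edge G u v) w \<le> 3"
proof (cases w)
  case (Old x)
  then show ?thesis using replace_edge_degree_Old[OF assms(1-3), of x] assms(4)
    by (auto simp: degree_def replace_edge_def)
next
  case (W c i)
  then have "i \<in> W_verts" using assms(4) by (auto simp: replace_edge_def)
  then obtain a b d where "{e \<in> edges (replace_edge G u v). W c i \<in> e} \<subseteq> {a, b, d}"
    using replace_edge_degree_W by metis
  then show ?thesis unfolding W by (rule degree_le3I)
next
  case X
  show ?thesis unfolding X
    by (rule degree_le3I[of _ _ "{W CopyA 4, X}" "{X, W CopyB 1}" "{X, W CopyD 1}"])
      (auto simp: replace_edge_def)
next
  case Y
  show ?thesis unfolding Y
    by (rule degree_le3I[of _ _ "{Y, W CopyC 1}" "{W CopyB 4, Y}" "{W CopyD 4, Y}"])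
      (auto simp: replace_edge_def)
qed

text \<open>Sides of the cuts are whole ranges of constructors. An image under \<open>Old\<close> or
  under \<open>W c\<close> then stays on one side whatever the edge is, and only the eight
  connecting edges have to be inspected.\<close>

lemma crossing_Old:
  assumes "e \<in> edges (replace_edge G u v)" "crossing (range Old) e"
  shows "e = {Old u, W CopyA 1} \<or> e = {W CopyC 4, Old v}"
  using assms by (auto simp: replace_edge_def crossing_def)

lemma crossing_copy_A:
  assumes "e \<in> edges (replace_edge G u v)" "crossing (range (W CopyA)) e"
  shows "e = {Old u, W CopyA 1} \<or> e = {W CopyA 4, X}"
  using assms by (auto simp: replace_edge_def crossing_def)

lemma crossing_copy_C:
  assumes "e \<in> edges (replace_edge G u v)" "crossing (range (W CopyC)) e"
  shows "e = {Y, W CopyC 1} \<or> e = {W CopyC 4, Old v}"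
  using assms by (auto simp: replace_edge_def crossing_def)

text \<open>Nonemptiness separates images under \<open>Old\<close> from images under
  \<open>W c\<close>, as the empty set is both; injectivity of \<open>Old\<close> then recovers the
  edge itself.\<close>

lemma Old_image_edge:
  fixes e :: "'a set"
  assumes "Old ` e \<in> edges (replace_edge G u v)" "e \<noteq> {}"
  shows "e \<in> edges G - {{u, v}}"
proof -
  have nW: "Old ` e \<noteq> W c ` f" for c f using assms(2) by auto
  have n: "Old ` e \<noteq> {x, y}" if "x \<notin> range Old \<or> y \<notin> range Old" for x y
    using that by blast
  have "Old ` e \<in> (`) Old ` (edges G - {{u, v}})"
    using assms(1) nW unfolding replace_edge_def by (auto simp: n simp del: image_eqI)
  then obtain f where "f \<in> edges G - {{u, v}}" "Old ` e = Old ` f" by blast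
  then show ?thesis by (metis inj_image_eq_iff gvert.inject(1) injI)
qed

section \<open>From the long trail to a Hamiltonian path\<close>

lemma trail_imp_path:
  fixes G :: "'a ugraph"
  assumes G: "simple_graph G" "cubic G" "{u, v} \<in> edges G"
    and tr: "trail (replace_edge G u v) p" "hd p = X"
      "walk_length p = card (verts (replace_edge G u v)) + 1"
  shows "\<exists>q. q \<noteq> [] \<and> distinct q \<and> set q = verts G \<and> set (walk_edges q) \<subseteq> edges G - {{u, v}} \<and>
       hd q = u \<and> last q = v"
proof -
  let ?G = "replace_edge G u v"
  have finG: "finite (verts G)" using G(1) by (simp add: simple_graph_def)
  have uv: "u \<in> verts G" "v \<in> verts G" "u \<noteq> v" using G(1,3) by (auto simp: simple_graph_def)
  note visits = long_trail_visits[OF finite_replace_edge_verts[OF finG] replace_edge_card2[OF G(1)]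
      replace_edge_degree[OF G] tr(1,3)]
  have p: "p \<noteq> []" "set (walk_edges p) \<subseteq> edges ?G" and dist: "distinct (walk_edges p)"
    using tr(1) by (auto simp: trail_def walk_def)
  have one: "count_list p w \<le> 1" if "w \<noteq> X" "w \<noteq> last p" for w
    using visits(3) that tr(2) by simp
  have in_p: "W c 1 \<in> set p" "Old u \<in> set p" for c
    using visits(2) uv by (auto simp: replace_edge_def W_verts_def)
  have not_Old: "last p \<notin> range Old"
  proof
    assume last: "last p \<in> range Old"
    \<comment> \<open>Both ends of the trail, \<open>X\<close> and an old vertex, lie outside copy
      \<open>A\<close>, whose vertices are all visited. The same holds for copy
      \<open>C\<close>.\<close>
    have "{Old u, W CopyA 1} \<in> set (walk_edges p)"
      by (rule both_crossings(1)[OF p(1) _ _ _ dist crossing_copy_A])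
        (use tr(2) last in_p(1)[of CopyA] p(2) in \<open>auto simp: disjoint_iff\<close>)
    moreover have "{W CopyC 4, Old v} \<in> set (walk_edges p)"
      by (rule both_crossings(2)[OF p(1) _ _ _ dist crossing_copy_C])
        (use tr(2) last in_p(1)[of CopyC] p(2) in \<open>auto simp: disjoint_iff\<close>)
    moreover have "crossing (range Old) {Old u, W CopyA 1}" "crossing (range Old) {W CopyC 4, Old v}"
      by (auto simp: crossing_def)
    moreover have "e = {Old u, W CopyA 1} \<or> e = {W CopyC 4, Old v}"
      if "e \<in> set (walk_edges p)" "crossing (range Old) e" for e
      using crossing_Old[of e G u v] that p(2) by blast
    ultimately have "set (filter (crossing (range Old)) (walk_edges p)) =
        {{Old u, W CopyA 1}, {W CopyC 4, Old v}}"
      by (intro equalityI subsetI) (simp_all, blast+)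
    then have "length (filter (crossing (range Old)) (walk_edges p)) =
        card {{Old u, W CopyA 1}, {W CopyC 4, Old v}}"
      using dist by (metis distinct_card distinct_filter)
    also have "\<dots> = 2" by (simp add: doubleton_eq_iff)
    \<comment> \<open>Two crossings would put both ends on the same side, but \<open>X\<close> is
      not old and \<open>last p\<close> is.\<close>
    finally show False using even_crossings[OF p(1), of "range Old"] tr(2) last by auto
  qed
  obtain p1 q0 p2 where s: "p = p1 @ q0 @ p2" "p1 \<noteq> []" "q0 \<noteq> []" "p2 \<noteq> []"
    "set p1 \<inter> range Old = {}" "set q0 \<subseteq> range Old" "set p2 \<inter> range Old = {}"
    "{{last p1, hd q0}, {last q0, hd p2}} = {{Old u, W CopyA 1}, {W CopyC 4, Old v}}"
    by (rule single_block[OF p(1) _ not_Old _ dist crossing_Old]) (use tr(2) in_p(2) p(2) in \<open>auto simp: disjoint_iff\<close>)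
  obtain q where q: "q0 = map Old q" using s(6) by (metis ex_map_conv rangeE subsetD)
  have qn: "q \<noteq> []" using q s(3) by simp
  \<comment> \<open>The only vertices that may be visited twice are the ends of the trail, and
    neither of them is old.\<close>
  have "count_list q0 w \<le> 1" for w
  proof (cases "w \<in> range Old")
    case True
    have "w \<noteq> X" using True by auto
    moreover have "w \<noteq> last p" using True not_Old by metis
    ultimately have "count_list p w \<le> 1" by (rule one)
    then show ?thesis using s(1) by simp
  next
    case False
    then show ?thesis using s(6) by (subst count_list_0_iff[THEN iffD2]) auto
  qed
  then have "distinct q0" by (rule count_list_le_1_imp_distinct)
  then have dq: "distinct q" using q by (simp add: distinct_map)
  \<comment> \<open>The trail visits every vertex, and outside \<open>q0\<close> it meets no old
    one.\<close>
  have "Old ` set q = set p \<inter> range Old" using s q by auto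
  also have "\<dots> = Old ` verts G" using visits(2) by (auto simp: replace_edge_def)
  finally have sq: "set q = verts G" by (simp add: inj_image_eq_iff inj_def)
  have "set (walk_edges q0) \<subseteq> edges ?G"
    using p(2) s(1-4) by (auto simp: walk_edges_append)
  then have wq: "set (walk_edges q) \<subseteq> edges G - {{u, v}}"
  proof (intro subsetI)
    fix e assume a: "e \<in> set (walk_edges q)" and sub: "set (walk_edges q0) \<subseteq> edges ?G"
    then have "Old ` e \<in> edges ?G" by (auto simp: q walk_edges_map)
    then show "e \<in> edges G - {{u, v}}" using walk_edges_nonempty[OF a] by (rule Old_image_edge)
  qed
  have "{hd q, last q} = {u, v}"
  proof -
    have "hd q0 = Old (hd q)" "last q0 = Old (last q)" using q qn by (auto simp: hd_map last_map)
    \<comment> \<open>Since the outer ends of the two crossing edges are not old, the inner ends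
      must be \<open>u\<close> and \<open>v\<close>, in an order still unknown.\<close>
    moreover have "last p1 \<notin> range Old" "hd p2 \<notin> range Old" using s by (auto simp: disjoint_iff)
    ultimately show ?thesis using s(8) by (auto simp: doubleton_eq_iff)
  qed
  then consider "hd q = u" "last q = v" | "hd q = v" "last q = u" by (auto simp: doubleton_eq_iff)
  then show ?thesis
  proof cases
    case 1
    then show ?thesis using qn dq sq wq by blast
  next
    case 2
    then show ?thesis using qn dq sq wq
      by (intro exI[of _ "rev q"]) (simp add: walk_edges_rev hd_rev last_rev)
  qed
qed

section \<open>From a Hamiltonian path to the long trail\<close>

definition W_path :: "copy \<Rightarrow> 'a gvert list" where
  "W_path c = [W c 4, W c 3, W c 2, W c 7, W c 8, W c 5, W c 6, W c 1]"

text \<open>\<open>W_path\<close> runs from vertex 4 to vertex 1, the direction in which the trail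
  passes \<open>A\<close>, \<open>C\<close> and \<open>D\<close>; only \<open>B\<close> is passed
  the other way. \<open>X\<close> occurs twice here, and \<open>Y\<close> once here and once at the
  end of \<open>gadget_end\<close>.\<close>

definition gadget_start :: "'a gvert list" where
  "gadget_start = [X] @ rev (W_path CopyB) @ [Y] @ W_path CopyD @ [X] @ W_path CopyA"

definition gadget_end :: "'a gvert list" where
  "gadget_end = W_path CopyC @ [Y]"

text \<open>\<open>X\<close> and \<open>Y\<close> are each visited twice, but one of these visits is
  an end of the trail, so three different edges suffice at each of them.\<close>

lemma distinct_gadget_edges:
  "distinct (walk_edges gadget_start @ walk_edges gadget_end)"
  by (simp add: gadget_start_def gadget_end_def W_path_def doubleton_eq_iff)

lemma gadget_edges_subset:
  "set (walk_edges gadget_start) \<union> set (walk_edges gadget_end) \<subseteq> edges (replace_edge (G :: 'a ugraph) u v)"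
proof -
  let ?E = "edges (replace_edge G u v)"
  have edge: "{W c i, W c j} \<in> ?E" if "{i, j} \<in> W_edges" for c i j
    unfolding replace_edge_def snd_conv
    by (rule UnI1, rule UnI2, rule CollectI, rule exI[of _ c], rule exI[of _ "{i, j}"]) (simp add: that)
  have path: "set (walk_edges (W_path c)) \<subseteq> ?E" for c
    using edge[of 4 3 c] edge[of 3 2 c] edge[of 2 7 c] edge[of 7 8 c] edge[of 8 5 c]
      edge[of 5 6 c] edge[of 6 1 c]
    by (simp add: W_path_def W_edges_def doubleton_eq_iff)
  have ends: "W_path c \<noteq> []" "hd (W_path c) = W c 4" "last (W_path c) = W c 1" for c
    by (simp_all add: W_path_def)
  have outer: "{X, W CopyB 1} \<in> ?E" "{W CopyB 4, Y} \<in> ?E" "{Y, W CopyD 4} \<in> ?E"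
    "{W CopyD 1, X} \<in> ?E" "{X, W CopyA 4} \<in> ?E" "{W CopyC 1, Y} \<in> ?E"
    unfolding replace_edge_def snd_conv by (rule UnI2, simp add: doubleton_eq_iff)+
  have "set (walk_edges gadget_start) = {{X, W CopyB 1}, {W CopyB 4, Y}, {Y, W CopyD 4}, {W CopyD 1, X}, {X, W CopyA 4}}
      \<union> set (walk_edges (W_path CopyB)) \<union> set (walk_edges (W_path CopyD))
      \<union> set (walk_edges (W_path CopyA :: 'a gvert list))"
    by (auto simp: gadget_start_def walk_edges_append walk_edges_Cons walk_edges_rev ends hd_rev last_rev)
  moreover have "set (walk_edges gadget_end) =
      insert {W CopyC 1, Y} (set (walk_edges (W_path CopyC :: 'a gvert list)))"
    by (auto simp: gadget_end_def walk_edges_append ends)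
  ultimately show ?thesis using path outer by simp
qed

lemma path_imp_trail:
  assumes G: "simple_graph G" "{u, v} \<in> edges G"
    and q: "q \<noteq> []" "distinct q" "set q = verts G" "set (walk_edges q) \<subseteq> edges G - {{u, v}}"
      "hd q = u" "last q = v"
  shows "\<exists>p. trail (replace_edge G u v) p \<and> hd p = X \<and>
      walk_length p = card (verts (replace_edge G u v)) + 1"
proof -
  let ?G = "replace_edge G u v"
  define p where "p = gadget_start @ map Old q @ gadget_end"
  have ends: "last (gadget_start :: 'a gvert list) = W CopyA 1" "(gadget_start :: 'a gvert list) \<noteq> []"
    "hd (gadget_end :: 'a gvert list) = W CopyC 4" "(gadget_end :: 'a gvert list) \<noteq> []"
    by (simp_all add: gadget_start_def gadget_end_def W_path_def)
  have we: "walk_edges p = walk_edges gadget_start @ {W CopyA 1, Old u} #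
      map ((`) Old) (walk_edges q) @ {Old v, W CopyC 4} # walk_edges gadget_end"
    using q ends by (simp add: p_def walk_edges_append walk_edges_map hd_map last_map)
  have no_Old: "x \<notin> range Old" if "x \<in> set gadget_start \<union> set gadget_end" for x :: "'a gvert"
    using that by (auto simp: gadget_start_def gadget_end_def W_path_def)
  \<comment> \<open>Edges of the trail are told apart by how they meet \<open>range Old\<close>:
    gadget edges miss it, edges of \<open>q\<close> lie inside it, and the two connecting edges have
    one end on each side.\<close>
  have gad: "e \<inter> range Old = {}" if "e \<in> set (walk_edges gadget_start) \<union> set (walk_edges gadget_end)" for e :: "'a gvert set"
    using that no_Old walk_edges_subset by blast
  have mid: "e \<noteq> {} \<and> e \<subseteq> range Old" if "e \<in> set (map ((`) Old) (walk_edges q))" for e :: "'a gvert set"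
    using that walk_edges_nonempty by auto
  have "distinct (map ((`) Old) (walk_edges q))"
    using distinct_walk_edges[OF q(2)] by (simp add: distinct_map inj_on_def inj_image_eq_iff inj_def)
  moreover have "set (walk_edges gadget_start) \<inter> set (map ((`) Old) (walk_edges q)) = {}"
    "set (walk_edges gadget_end) \<inter> set (map ((`) Old) (walk_edges q)) = {}"
    using gad mid by blast+
  moreover have "e \<notin> set (walk_edges gadget_start)" "e \<notin> set (walk_edges gadget_end)"
    "e \<notin> set (map ((`) Old) (walk_edges q))"
    if "e = {W CopyA 1, Old u} \<or> e = {Old v, W CopyC 4}" for e :: "'a gvert set"
    using that gad[of e] mid[of e] by blast+
  moreover have "{W CopyA 1, Old u} \<noteq> {Old v, W CopyC 4}" by (simp add: doubleton_eq_iff)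
  ultimately have "distinct (walk_edges p)"
    using distinct_gadget_edges[where 'a = 'a] unfolding we by (auto simp del: set_map)
  moreover have "set (walk_edges p) \<subseteq> edges ?G"
  proof -
    have "{W CopyA 1, Old u} \<in> edges ?G" "{Old v, W CopyC 4} \<in> edges ?G"
      unfolding replace_edge_def snd_conv by (rule UnI2, simp add: doubleton_eq_iff)+
    moreover have "(`) Old ` set (walk_edges q) \<subseteq> edges ?G"
      using image_mono[OF q(4), of "(`) Old"]
      unfolding replace_edge_def snd_conv by (intro le_supI1)
    ultimately show ?thesis using gadget_edges_subset[of G u v] unfolding we by simp
  qed
  moreover have "set p \<subseteq> verts ?G"
    using q(3) by (auto simp: p_def gadget_start_def gadget_end_def W_path_def replace_edge_def W_verts_def)
  ultimately have "trail ?G p" by (simp add: trail_def walk_def p_def ends)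
  moreover have "hd p = X" by (simp add: p_def gadget_start_def)
  moreover have "walk_length p = card (verts ?G) + 1"
  proof -
    have "finite (verts G)" using G(1) by (simp add: simple_graph_def)
    \<comment> \<open>The gadget lists have 27 and 9 entries, so \<open>p\<close> has |V(G)| + 36
      entries and |V(G)| + 35 edges, against |V(G)| + 34 vertices in the new graph.\<close>
    then show ?thesis using distinct_card[OF q(2)] q(3) card_replace_edge_verts[of G u v]
      by (simp add: walk_length_def length_walk_edges p_def gadget_start_def gadget_end_def W_path_def)
  qed
  ultimately show ?thesis by blast
qed

theorem theorem5p3:
  fixes G :: "'a ugraph" and u v :: 'a
  assumes "simple_graph G" and "planar G" and "cubic G" and "bipartite G"
    and "{u, v} \<in> edges G"
  defines "G' \<equiv> replace_edge G u v"
  shows "(\<exists>p. hamiltonian_cycle G p \<and> {u, v} \<in> set (walk_edges p)) \<longleftrightarrow>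
         (\<exists>p. trail G' p \<and> hd p = X \<and> walk_length p = card (verts G') + 1)"
proof -
  have "u \<noteq> v" using assms(1,5) by (auto simp: simple_graph_def)
  then show ?thesis
    unfolding G'_def hamiltonian_cycle_iff_path[OF assms(5) \<open>u \<noteq> v\<close>]
    using trail_imp_path[OF assms(1,3,5)] path_imp_trail[OF assms(1,5)] by blast
qed

end
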